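(* Let $(X,\nu,\mathcal{T}_1,\tau_1)$ be a Type 1 computable topological space which satisfies the Markov condition with respect to effective sequential closure, i.e. $$\forall x\in X,\ \forall A\subseteq X,\ \big(x\notin A\ \&\ x\in\overline{A}^{+\mathrm{seq}}\big)\implies A\rightsquigarrow_\nu\{x\},$$ and which satisfies the identification condition between the closure and the effective sequential closure for semi-decidable sets, i.e. $\overline{A}=\overline{A}^{+\mathrm{seq}}$ for every $\nu$-semi-decidable $A\subseteq X$. Let $(Y,\mu,\mathcal{T}_2,\tau_2)$ be a Type 1 computable topological space in which every point has an effective neighborhood basis of co-semi-decidable sets. Then every $(\nu,\mu)$-computable function $f:X\to Y$ is $(\mathcal{T}_1,\mathcal{T}_2)$-continuous.
   Context: A numbering of a set $X$ is a surjection $\nu$ from a subset $\mathrm{dom}(\nu)\subseteq\mathbb{N}$ onto $X$; a subnumbering of $X$ is a numbering of a subset of $X$. If $\nu(n)=x$, $n$ is a $\nu$-name of $x$. $\varphi_0,\varphi_1,\dots$ is a standard enumeration of the partial recursive functions. For numbered sets $(X,\nu),(Y,\mu)$, a map $f:X\to Y$ is $(\nu,\mu)$-computable if there is a partial computable $F$ defined on $\mathrm{dom}(\nu)$ with $\mu(F(n))=f(\nu(n))$ for all $n\in\mathrm{dom}(\nu)$. A set $A\subseteq X$ is $\nu$-semi-decidable if there is $e$ with $\varphi_e(i)\downarrow\iff\nu(i)\in A$ for all $i\in\mathrm{dom}(\nu)$; such $e$ is a $\nu_{SD}$-name of $A$. A set is $\nu$-co-semi-decidable if its complement is $\nu$-semi-decidable.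 For $B\subseteq C\subseteq X$, $B$ is a $\nu$-semi-decidable subset of $C$ if there is $e$ such that for all $i\in\mathrm{dom}(\nu)$ with $\nu(i)\in C$: $\varphi_e(i)\downarrow\iff\nu(i)\in B$. One writes $A\rightsquigarrow_\nu B$ iff $B$ is not a $\nu$-semi-decidable subset of $A\cup B$. For subnumberings $\alpha,\beta$ of a set, $\alpha\le\beta$ means there is a partial computable $F$ defined on $\mathrm{dom}(\alpha)$ with $\beta(F(n))=\alpha(n)$. A sequence $(u_n)$ in $X$ is $\nu$-computable if there is a total computable $g$ with $g(n)\in\mathrm{dom}(\nu)$ and $\nu(g(n))=u_n$ for all $n$. A Type 1 computable topological space is a quadruple $(X,\nu,\mathcal{T},\tau)$ where $\mathcal{T}$ is a topology on $X$, $\nu$ a numbering of $X$, $\tau$ a subnumbering of $\mathcal{T}$, such that: the image of $\tau$ generates $\mathcal{T}$ as a basis; $\emptyset$ and $X$ are in the image of $\tau$; $\tau\le\nu_{SD}$; there is a computable procedure which, given an index of a total computable $g$ with values in $\mathrm{dom}(\tau)$, outputs a $\tau$-name of $\bigcup_n\tau(g(n))$; and there is a computable procedure which from $\tau$-names of $O_1,O_2$ outputs a $\tau$-name of $O_1\cap O_2$. Sets in the image of $\tau$ are the effective open sets. For $A\subseteq X$, the effective sequential closure $\overline{A}^{+\mathrm{seq}}$ is the set of all limits (in $\mathcal{T}$) of $\nu$-computable sequences of elements of $A$ that converge; $\overline{A}$ denotes the usual closure. For $x\in X$, let $\mathfrak{n}_x$ be the multi-numbering of neighborhoods of $x$: its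 names are the $\tau$-names $n$ with $x\in\tau(n)$, and $n$ names every set $A\supseteq\tau(n)$. An effective neighborhood basis of $x$ is a pair $(\mathcal{B}_x,\beta_x)$ with $\mathcal{B}_x$ a neighborhood basis of $x$ and $\beta_x$ a numbering of $\mathcal{B}_x$, such that there is a computable procedure which, given any $\mathfrak{n}_x$-name $n$, produces a $\beta_x$-name of some $B\in\mathcal{B}_x$ with $B\subseteq\tau(n)$. The point $x$ has an effective neighborhood basis of co-semi-decidable sets if there is such a pair in which every $\beta_x(n)$ is co-semi-decidable for the numbering of the space. *)

theory Defs
  imports "HOL-Analysis.Analysis" "HOL-Library.Nat_Bijection"
begin

section \<open>Partial recursive functions\<close>

datatype recf = Zero | Succ | Proj nat | Comp recf "recf list" | Prec recf recf | Mu recf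

text \<open>
  Kleene's schemes. Arguments are passed as a list, so that a code denotes a partial function of
  every arity at once; on arguments of the wrong number it may be undefined. The composite
  \<open>Comp f gs\<close> is strict: it is defined only where all of \<open>gs\<close> are. \<open>Mu f\<close> is defined at \<open>xs\<close> only
  if \<open>f\<close> is defined below the least zero as well.
\<close>

fun eval :: "recf \<Rightarrow> nat list \<Rightarrow> nat option" where
  "eval Zero xs = Some 0"
| "eval Succ xs = (case xs of [] \<Rightarrow> None | x # _ \<Rightarrow> Some (Suc x))"
| "eval (Proj i) xs = (if i < length xs then Some (xs ! i) else None)"
| "eval (Comp f gs) xs =
     (case those (map (\<lambda>g. eval g xs) gs) of None \<Rightarrow> None | Some ys \<Rightarrow> eval f ys)"
| "eval (Prec f g) xs =
     (case xs of [] \<Rightarrow> None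
      | n # zs \<Rightarrow> rec_nat (eval f zs)
          (\<lambda>m r. case r of None \<Rightarrow> None | Some y \<Rightarrow> eval g (m # y # zs)) n)"
| "eval (Mu f) xs =
     (if \<exists>n. eval f (n # xs) = Some 0 \<and> (\<forall>m<n. eval f (m # xs) \<noteq> None)
      then Some (LEAST n. eval f (n # xs) = Some 0) else None)"

lemma list_decode_le: "x \<in> set (list_decode n) \<Longrightarrow> x \<le> n"
proof (induction n rule: list_decode.induct)
  case (2 n)
  obtain a b where ab: "prod_decode n = (a, b)" by fastforce
  then have n: "n = prod_encode (a, b)" by (metis prod_decode_inverse)
  have "a \<le> n" "b \<le> n" unfolding n by (rule le_prod_encode_1, rule le_prod_encode_2)
  then show ?case using 2 ab by force
qed simp

lemma fst_prod_decode_le: "fst (prod_decode n) \<le> n"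
  by (metis le_prod_encode_1 prod.collapse prod_decode_inverse)

lemma snd_prod_decode_le: "snd (prod_decode n) \<le> n"
  by (metis le_prod_encode_2 prod.collapse prod_decode_inverse)

function recf_of_nat :: "nat \<Rightarrow> recf" where
  "recf_of_nat n =
    (if n mod 6 = 0 then Zero
     else if n mod 6 = 1 then Succ
     else if n mod 6 = 2 then Proj (n div 6)
     else if n mod 6 = 3 then
       Comp (recf_of_nat (fst (prod_decode (n div 6))))
         (map recf_of_nat (list_decode (snd (prod_decode (n div 6)))))
     else if n mod 6 = 4 then
       Prec (recf_of_nat (fst (prod_decode (n div 6)))) (recf_of_nat (snd (prod_decode (n div 6))))
     else Mu (recf_of_nat (n div 6)))"
  by pat_completeness auto
termination
proof (relation "less_than")
  have *: "k \<le> n div 6 \<Longrightarrow> n mod 6 \<noteq> 0 \<Longrightarrow> k < n" for k n :: nat by presburger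
  fix n z :: nat
  assume "n mod 6 \<noteq> 0"
  then show "(fst (prod_decode (n div 6)), n) \<in> less_than"
    and "(fst (prod_decode (n div 6)), n) \<in> less_than"
    and "(snd (prod_decode (n div 6)), n) \<in> less_than"
    and "(n div 6, n) \<in> less_than"
    using * fst_prod_decode_le snd_prod_decode_le by auto
  show "(z, n) \<in> less_than" if "z \<in> set (list_decode (snd (prod_decode (n div 6))))"
    using *[OF order_trans[OF list_decode_le[OF that] snd_prod_decode_le] \<open>n mod 6 \<noteq> 0\<close>] by simp
qed auto

declare recf_of_nat.simps [simp del]

lemma surj_recf_of_nat: "surj recf_of_nat"
proof -
  have digit: "(6 * k + d) mod 6 = d" "(6 * k + d) div 6 = k" if "d < 6" for k d :: nat
    using that by auto
  have "\<exists>n. recf_of_nat n = r" for r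
  proof (induction r)
    case Zero
    have "recf_of_nat 0 = Zero" by (subst recf_of_nat.simps) (simp add: digit del: add_2_eq_Suc add_2_eq_Suc')
    then show ?case ..
  next
    case Succ
    have "recf_of_nat 1 = Succ" by (subst recf_of_nat.simps) (simp add: digit del: add_2_eq_Suc add_2_eq_Suc')
    then show ?case ..
  next
    case (Proj i)
    have "recf_of_nat (6 * i + 2) = Proj i" by (subst recf_of_nat.simps) (simp add: digit del: add_2_eq_Suc add_2_eq_Suc')
    then show ?case ..
  next
    case (Comp f gs)
    then obtain a where a: "recf_of_nat a = f" by blast
    from Comp obtain e where "\<forall>g\<in>set gs. recf_of_nat (e g) = g" by metis
    then have gs: "map (recf_of_nat \<circ> e) gs = gs" by (simp add: map_idI)
    have "recf_of_nat (6 * prod_encode (a, list_encode (map e gs)) + 3) = Comp f gs"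
      by (subst recf_of_nat.simps) (simp add: digit a gs)
    then show ?case ..
  next
    case (Prec f g)
    then obtain a b where "recf_of_nat a = f" "recf_of_nat b = g" by blast
    then have "recf_of_nat (6 * prod_encode (a, b) + 4) = Prec f g"
      by (subst recf_of_nat.simps) (simp add: digit del: add_2_eq_Suc add_2_eq_Suc')
    then show ?case ..
  next
    case (Mu f)
    then obtain a where "recf_of_nat a = f" by blast
    then have "recf_of_nat (6 * a + 5) = Mu f"
      by (subst recf_of_nat.simps) (simp add: digit del: add_2_eq_Suc add_2_eq_Suc')
    then show ?case ..
  qed
  then show ?thesis by (metis surjI)
qed

definition phi :: "nat \<Rightarrow> nat \<rightharpoonup> nat" where
  "phi e = (\<lambda>n. eval (recf_of_nat e) [n])"

text \<open>Functions of two arguments are computed on the Cantor pairing \<^const>\<open>prod_encode\<close>.\<close>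

definition partial_computable :: "(nat \<rightharpoonup> nat) \<Rightarrow> bool" where
  "partial_computable F \<longleftrightarrow> F \<in> range phi"

definition total_computable :: "(nat \<Rightarrow> nat) \<Rightarrow> bool" where
  "total_computable g \<longleftrightarrow> partial_computable (\<lambda>n. Some (g n))"


section \<open>Numberings\<close>

text \<open>A (sub)numbering is a partial map from the naturals, with \<open>\<nu> n = Some x\<close> if \<open>n\<close> names \<open>x\<close>.\<close>

definition numbering :: "(nat \<rightharpoonup> 'a) \<Rightarrow> 'a set \<Rightarrow> bool" where
  "numbering \<nu> X \<longleftrightarrow> ran \<nu> = X"

definition subnumbering :: "(nat \<rightharpoonup> 'a) \<Rightarrow> 'a set \<Rightarrow> bool" where
  "subnumbering \<nu> X \<longleftrightarrow> (\<exists>Y\<subseteq>X. numbering \<nu> Y)"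

definition computable_map :: "(nat \<rightharpoonup> 'a) \<Rightarrow> (nat \<rightharpoonup> 'b) \<Rightarrow> ('a \<Rightarrow> 'b) \<Rightarrow> bool" where
  "computable_map \<nu> \<mu> f \<longleftrightarrow>
    (\<exists>F. partial_computable F \<and>
      (\<forall>n x. \<nu> n = Some x \<longrightarrow> (\<exists>m. F n = Some m \<and> \<mu> m = Some (f x))))"

definition reducible :: "(nat \<rightharpoonup> 'a) \<Rightarrow> (nat \<rightharpoonup> 'a) \<Rightarrow> bool" where
  "reducible \<alpha> \<beta> \<longleftrightarrow>
    (\<exists>F. partial_computable F \<and>
      (\<forall>n x. \<alpha> n = Some x \<longrightarrow> (\<exists>m. F n = Some m \<and> \<beta> m = Some x)))"

definition computable_sequence :: "(nat \<rightharpoonup> 'a) \<Rightarrow> (nat \<Rightarrow> 'a) \<Rightarrow> bool" where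
  "computable_sequence \<nu> u \<longleftrightarrow>
    (\<exists>g. total_computable g \<and> (\<forall>n. \<nu> (g n) = Some (u n)))"


section \<open>Semi-decidability\<close>

text \<open>Here \<^term>\<open>ran \<nu>\<close> is the numbered set.\<close>

definition sd_name :: "(nat \<rightharpoonup> 'a) \<Rightarrow> nat \<Rightarrow> 'a set \<Rightarrow> bool" where
  "sd_name \<nu> e A \<longleftrightarrow>
    A \<subseteq> ran \<nu> \<and> (\<forall>i x. \<nu> i = Some x \<longrightarrow> (phi e i \<noteq> None \<longleftrightarrow> x \<in> A))"

definition semi_decidable :: "(nat \<rightharpoonup> 'a) \<Rightarrow> 'a set \<Rightarrow> bool" where
  "semi_decidable \<nu> A \<longleftrightarrow> (\<exists>e. sd_name \<nu> e A)"

definition co_semi_decidable :: "(nat \<rightharpoonup> 'a) \<Rightarrow> 'a set \<Rightarrow> bool" where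
  "co_semi_decidable \<nu> A \<longleftrightarrow> A \<subseteq> ran \<nu> \<and> semi_decidable \<nu> (ran \<nu> - A)"

definition sd_numbering :: "(nat \<rightharpoonup> 'a) \<Rightarrow> (nat \<rightharpoonup> 'a set)" where
  "sd_numbering \<nu> e = (if \<exists>A. sd_name \<nu> e A then Some (THE A. sd_name \<nu> e A) else None)"

lemma sd_name_unique: "sd_name \<nu> e A \<Longrightarrow> sd_name \<nu> e B \<Longrightarrow> A = B"
  unfolding sd_name_def ran_def by blast

lemma sd_numbering_eq_Some_iff: "sd_numbering \<nu> e = Some A \<longleftrightarrow> sd_name \<nu> e A"
proof -
  have "(THE A. sd_name \<nu> e A) = A" if "sd_name \<nu> e A" for A
    using that sd_name_unique by (intro the_equality) auto
  then show ?thesis unfolding sd_numbering_def by auto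
qed

definition sd_subset_of :: "(nat \<rightharpoonup> 'a) \<Rightarrow> 'a set \<Rightarrow> 'a set \<Rightarrow> bool" where
  "sd_subset_of \<nu> B C \<longleftrightarrow>
    B \<subseteq> C \<and> C \<subseteq> ran \<nu> \<and>
    (\<exists>e. \<forall>i x. \<nu> i = Some x \<and> x \<in> C \<longrightarrow> (phi e i \<noteq> None \<longleftrightarrow> x \<in> B))"

definition leadsto :: "(nat \<rightharpoonup> 'a) \<Rightarrow> 'a set \<Rightarrow> 'a set \<Rightarrow> bool" where
  "leadsto \<nu> A B \<longleftrightarrow> \<not> sd_subset_of \<nu> B (A \<union> B)"


section \<open>Type 1 computable topological spaces\<close>

locale type1_computable_topological_space =
  fixes \<nu> :: "nat \<rightharpoonup> 'a" and T :: "'a topology" and \<tau> :: "nat \<rightharpoonup> 'a set"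
  assumes numbering: "numbering \<nu> (topspace T)"
    and subnumbering: "subnumbering \<tau> {U. openin T U}"
    and basis: "openin T = arbitrary union_of (\<lambda>U. U \<in> ran \<tau>)"
    and empty: "{} \<in> ran \<tau>"
    and space: "topspace T \<in> ran \<tau>"
    and reducible_sd: "reducible \<tau> (sd_numbering \<nu>)"
    and union: "\<exists>F. partial_computable F \<and>
      (\<forall>e g U. (\<forall>n. phi e n = Some (g n) \<and> \<tau> (g n) = Some (U n)) \<longrightarrow>
        (\<exists>m. F e = Some m \<and> \<tau> m = Some (\<Union>n. U n)))"
    and inter: "\<exists>F. partial_computable F \<and>
      (\<forall>k l U V. \<tau> k = Some U \<and> \<tau> l = Some V \<longrightarrow>
        (\<exists>m. F (prod_encode (k, l)) = Some m \<and> \<tau> m = Some (U \<inter> V)))"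

definition effective_sequential_closure ::
    "(nat \<rightharpoonup> 'a) \<Rightarrow> 'a topology \<Rightarrow> 'a set \<Rightarrow> 'a set" where
  "effective_sequential_closure \<nu> T A =
    {x. \<exists>u. computable_sequence \<nu> u \<and> (\<forall>n. u n \<in> A) \<and> limitin T u x sequentially}"

definition neighborhood :: "'a topology \<Rightarrow> 'a \<Rightarrow> 'a set \<Rightarrow> bool" where
  "neighborhood T x N \<longleftrightarrow> N \<subseteq> topspace T \<and> (\<exists>U. openin T U \<and> x \<in> U \<and> U \<subseteq> N)"

definition neighborhood_basis :: "'a topology \<Rightarrow> 'a \<Rightarrow> 'a set set \<Rightarrow> bool" where
  "neighborhood_basis T x \<B> \<longleftrightarrow>
    (\<forall>B\<in>\<B>. neighborhood T x B) \<and> (\<forall>N. neighborhood T x N \<longrightarrow> (\<exists>B\<in>\<B>. B \<subseteq> N))"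

text \<open>A multi-numbering assigns to a natural the set of all objects it names; the naturals with
  nonempty value are the names.\<close>

definition neighborhood_multi_numbering ::
    "'a topology \<Rightarrow> (nat \<rightharpoonup> 'a set) \<Rightarrow> 'a \<Rightarrow> nat \<Rightarrow> 'a set set" where
  "neighborhood_multi_numbering T \<tau> x n =
    {A. A \<subseteq> topspace T \<and> (\<exists>U. \<tau> n = Some U \<and> x \<in> U \<and> U \<subseteq> A)}"

definition effective_neighborhood_basis ::
    "'a topology \<Rightarrow> (nat \<rightharpoonup> 'a set) \<Rightarrow> 'a \<Rightarrow> 'a set set \<Rightarrow> (nat \<rightharpoonup> 'a set) \<Rightarrow> bool" where
  "effective_neighborhood_basis T \<tau> x \<B> \<beta> \<longleftrightarrow>
    neighborhood_basis T x \<B> \<and> numbering \<beta> \<B> \<and>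
    (\<exists>F. partial_computable F \<and>
      (\<forall>n U. \<tau> n = Some U \<and> neighborhood_multi_numbering T \<tau> x n \<noteq> {} \<longrightarrow>
        (\<exists>m B. F n = Some m \<and> \<beta> m = Some B \<and> B \<subseteq> U)))"

end

(* A preimage A of the complement of a co-semi-decidable neighborhood B of f x is semi-decidable.
   If x lay in the closure of A, the Markov condition would forbid telling x apart from the points
   of A. But an effective open W with f x in W and W contained in B does this: on the union of A
   and {x}, a point z equals x iff f z lies in W. *)
theory Submission
  imports Defs
begin

text \<open>\<open>Comp\<close> with a one-element argument list is strict, just as
  \<open>\<circ>\<^sub>m\<close> is, and surjectivity of \<open>recf_of_nat\<close> supplies an
  index for the composite code.\<close>

lemma partial_computable_comp:
  assumes "partial_computable F" "partial_computable G"
  shows "partial_computable (F \<circ>\<^sub>m G)"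
proof -
  obtain a b where F: "F = phi a" and G: "G = phi b"
    using assms unfolding partial_computable_def by blast
  obtain e where e: "recf_of_nat e = Comp (recf_of_nat a) [recf_of_nat b]"
    using surj_recf_of_nat by (metis surjD)
  have "phi e = F \<circ>\<^sub>m G"
    unfolding F G by (auto simp: phi_def e map_comp_def fun_eq_iff split: option.splits)
  then show ?thesis unfolding partial_computable_def by (metis rangeI)
qed

text \<open>Run a realizer of \<open>f\<close> on a name of \<open>x\<close>, then the semi-decision
  procedure of \<open>B\<close> on the resulting name of \<open>f x\<close>. The index itself is
  exposed because it can then also be used on a subset such as
  \<open>A \<union> {x}\<close>.\<close>

lemma semi_decidable_preimage_name:
  assumes "semi_decidable \<mu> B" "computable_map \<nu> \<mu> f"
  obtains e where "\<And>i x. \<nu> i = Some x \<Longrightarrow> phi e i \<noteq> None \<longleftrightarrow> f x \<in> B"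
proof -
  obtain b where b: "sd_name \<mu> b B"
    using assms(1) unfolding semi_decidable_def by blast
  obtain F where F: "partial_computable F"
      "\<And>n x. \<nu> n = Some x \<Longrightarrow> \<exists>m. F n = Some m \<and> \<mu> m = Some (f x)"
    using assms(2) unfolding computable_map_def by blast
  have "partial_computable (phi b \<circ>\<^sub>m F)"
    by (intro partial_computable_comp F) (simp add: partial_computable_def)
  then obtain e where e: "phi e = phi b \<circ>\<^sub>m F"
    unfolding partial_computable_def by (metis imageE)
  have "phi e i \<noteq> None \<longleftrightarrow> f x \<in> B" if i: "\<nu> i = Some x" for i x
  proof -
    obtain m where "F i = Some m" "\<mu> m = Some (f x)"
      using F(2)[OF i] by blast
    with b show ?thesis unfolding e sd_name_def by simp
  qed
  with that show thesis by blast
qed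

lemma semi_decidable_preimage:
  assumes "semi_decidable \<mu> B" "computable_map \<nu> \<mu> f"
  shows "semi_decidable \<nu> {x \<in> ran \<nu>. f x \<in> B}"
proof -
  obtain e where "\<And>i x. \<nu> i = Some x \<Longrightarrow> phi e i \<noteq> None \<longleftrightarrow> f x \<in> B"
    using semi_decidable_preimage_name[OF assms] by blast
  then have "sd_name \<nu> e {x \<in> ran \<nu>. f x \<in> B}"
    unfolding sd_name_def by (auto intro: ranI)
  then show ?thesis unfolding semi_decidable_def by blast
qed

text \<open>The reduction of \<open>\<tau>\<close> to \<open>sd_numbering \<nu>\<close> turns a name
  of \<open>W\<close> into an index semi-deciding it.\<close>

lemma (in type1_computable_topological_space) effective_open_semi_decidable:
  assumes "W \<in> ran \<tau>"
  shows "semi_decidable \<nu> W"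
proof -
  obtain n where "\<tau> n = Some W" using assms by (auto simp: ran_def)
  then obtain m where "sd_numbering \<nu> m = Some W"
    using reducible_sd unfolding reducible_def by blast
  then show ?thesis by (auto simp: sd_numbering_eq_Some_iff semi_decidable_def)
qed

text \<open>An open set is a union of effective open sets, and one member of the union contains
  \<open>x\<close>.\<close>

lemma (in type1_computable_topological_space) neighborhood_effective_open:
  assumes "neighborhood T x N"
  obtains W where "W \<in> ran \<tau>" "x \<in> W" "W \<subseteq> N"
proof -
  obtain U where U: "openin T U" "x \<in> U" "U \<subseteq> N"
    using assms unfolding neighborhood_def by blast
  then have "(arbitrary union_of (\<lambda>U. U \<in> ran \<tau>)) U" using basis by simp
  then obtain \<U> where "\<U> \<subseteq> ran \<tau>" "\<Union>\<U> = U"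
    by (auto simp: union_of_def)
  with U that show thesis by blast
qed

theorem mainTheorem2:
  fixes \<nu> :: "nat \<rightharpoonup> 'a" and T1 :: "'a topology" and \<tau>1 :: "nat \<rightharpoonup> 'a set"
    and \<mu> :: "nat \<rightharpoonup> 'b" and T2 :: "'b topology" and \<tau>2 :: "nat \<rightharpoonup> 'b set"
    and f :: "'a \<Rightarrow> 'b"
  assumes "type1_computable_topological_space \<nu> T1 \<tau>1"
    and markov: "\<forall>x\<in>topspace T1. \<forall>A\<subseteq>topspace T1.
      x \<notin> A \<and> x \<in> effective_sequential_closure \<nu> T1 A \<longrightarrow> leadsto \<nu> A {x}"
    and identification: "\<forall>A\<subseteq>topspace T1.
      semi_decidable \<nu> A \<longrightarrow> T1 closure_of A = effective_sequential_closure \<nu> T1 A"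
    and "type1_computable_topological_space \<mu> T2 \<tau>2"
    and "\<forall>y\<in>topspace T2. \<exists>\<B> \<beta>. effective_neighborhood_basis T2 \<tau>2 y \<B> \<beta> \<and>
      (\<forall>n B. \<beta> n = Some B \<longrightarrow> co_semi_decidable \<mu> B)"
    and "f \<in> topspace T1 \<rightarrow> topspace T2"
    and "computable_map \<nu> \<mu> f"
  shows "continuous_map T1 T2 f"
proof -
  interpret X: type1_computable_topological_space \<nu> T1 \<tau>1 by fact
  interpret Y: type1_computable_topological_space \<mu> T2 \<tau>2 by fact
  have X: "ran \<nu> = topspace T1" and Y: "ran \<mu> = topspace T2"
    using X.numbering Y.numbering by (simp_all add: numbering_def)
  \<comment> \<open>Continuity is shown pointwise: each point of a preimage of an open set has an
    open neighborhood inside that preimage.\<close>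
  have "\<exists>U. openin T1 U \<and> x \<in> U \<and> U \<subseteq> {z \<in> topspace T1. f z \<in> V}"
    if V: "openin T2 V" and x: "x \<in> topspace T1" and fx: "f x \<in> V" for V x
  proof -
    have "f x \<in> topspace T2" using x assms(6) by blast
    then obtain \<B> \<beta> where basis: "neighborhood_basis T2 (f x) \<B>" "numbering \<beta> \<B>"
        and co: "\<And>n B. \<beta> n = Some B \<Longrightarrow> co_semi_decidable \<mu> B"
      using assms(5) unfolding effective_neighborhood_basis_def by meson
    have "neighborhood T2 (f x) V"
      using V fx openin_subset unfolding neighborhood_def by blast
    then obtain B where B: "B \<in> \<B>" "B \<subseteq> V" "neighborhood T2 (f x) B"
      using basis(1) unfolding neighborhood_basis_def by blast
    then have "co_semi_decidable \<mu> B"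
      using co basis(2) unfolding numbering_def ran_def by blast
    then have sd: "semi_decidable \<mu> (topspace T2 - B)"
      by (simp add: co_semi_decidable_def Y)
    obtain W where W: "W \<in> ran \<tau>2" "f x \<in> W" "W \<subseteq> B"
      using Y.neighborhood_effective_open[OF B(3)] by blast
    define A where "A = {z \<in> topspace T1. f z \<in> topspace T2 - B}"
    have A: "A \<subseteq> topspace T1" "semi_decidable \<nu> A"
      using semi_decidable_preimage[OF sd assms(7)] by (auto simp: A_def X)
    have "x \<notin> T1 closure_of A"
    proof
      assume "x \<in> T1 closure_of A"
      \<comment> \<open>Semi-decidability of \<open>A\<close> is what lets the identification
        condition replace the closure by the effective sequential one.\<close>
      then have "x \<in> effective_sequential_closure \<nu> T1 A"
        using identification A by blast
      \<comment> \<open>The Markov condition requires this; it holds because \<open>f x\<close> lies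
        in \<open>W\<close>, hence in \<open>B\<close>.\<close>
      moreover have "x \<notin> A" using W by (auto simp: A_def)
      ultimately have "\<not> sd_subset_of \<nu> {x} (A \<union> {x})"
        using markov x A(1) unfolding leadsto_def by blast
      moreover obtain e where e: "\<And>i z. \<nu> i = Some z \<Longrightarrow> phi e i \<noteq> None \<longleftrightarrow> f z \<in> W"
        using semi_decidable_preimage_name[OF Y.effective_open_semi_decidable[OF W(1)] assms(7)]
        by blast
      \<comment> \<open>Points of \<open>A\<close> are sent outside \<open>B\<close>, hence outside
        \<open>W\<close>. Points sent into \<open>B - W\<close> would spoil the test only if they
        differed from \<open>x\<close> and lay in \<open>A\<close>, which they never do.\<close>
      have "f z \<in> W \<longleftrightarrow> z \<in> {x}" if "z \<in> A \<union> {x}" for z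
        using that W by (auto simp: A_def)
      with e have "\<forall>i z. \<nu> i = Some z \<and> z \<in> A \<union> {x} \<longrightarrow> (phi e i \<noteq> None \<longleftrightarrow> z \<in> {x})"
        by metis
      then have "sd_subset_of \<nu> {x} (A \<union> {x})"
        using A(1) x unfolding sd_subset_of_def X by blast
      ultimately show False by blast
    qed
    \<comment> \<open>A point outside the closure is outside \<open>A\<close>, so its image lies in
      \<open>B\<close> and thus in \<open>V\<close>. This complement is the open neighborhood of
      \<open>x\<close> sought.\<close>
    moreover have "topspace T1 - T1 closure_of A \<subseteq> {z \<in> topspace T1. f z \<in> V}"
      using closure_of_subset[OF A(1)] assms(6) B(2) by (auto simp: A_def)
    ultimately show ?thesis
      using x by (intro exI[of _ "topspace T1 - T1 closure_of A"]) auto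
  qed
  then have "openin T1 {z \<in> topspace T1. f z \<in> V}" if "openin T2 V" for V
    using that by (subst openin_subopen) blast
  with assms(6) show ?thesis by (simp add: continuous_map_def)
qed

end
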